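(* Let $K\subseteq L$ be a field extension of degree $2$ and let $A$ be a group of the form $L^\times/K^\times$. Then the rational rank of $A$ is either $0$ or infinite.
   Context: The rational rank of a commutative group $A$ is the cardinality of a maximal $\mathbb{Z}$-linearly independent subset of $A$; equivalently, it is $\dim_{\mathbb{Q}}(A\otimes_{\mathbb{Z}}\mathbb{Q})$. *)

theory Defs
  imports "HOL-Algebra.Algebra"
begin

unbundle cardinal_syntax

text \<open>Commutative groups are written multiplicatively, so a \<open>\<int>\<close>-linear combination of the
  elements of a finite set \<open>T\<close> with coefficients \<open>c\<close> is the product over \<open>T\<close> of the
  powers \<open>x [^] c x\<close>.\<close>

definition Z_independent :: "('a, 'b) monoid_scheme \<Rightarrow> 'a set \<Rightarrow> bool" where
  "Z_independent G S \<longleftrightarrow> S \<subseteq> carrier G \<and>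
     (\<forall>T (c :: 'a \<Rightarrow> int). finite T \<longrightarrow> T \<subseteq> S \<longrightarrow>
        finprod G (\<lambda>x. x [^]\<^bsub>G\<^esub> c x) T = \<one>\<^bsub>G\<^esub> \<longrightarrow> (\<forall>x\<in>T. c x = 0))"

definition maximal_Z_independent :: "('a, 'b) monoid_scheme \<Rightarrow> 'a set \<Rightarrow> bool" where
  "maximal_Z_independent G S \<longleftrightarrow> Z_independent G S \<and>
     (\<forall>S'. Z_independent G S' \<longrightarrow> S \<subseteq> S' \<longrightarrow> S' = S)"

text \<open>The rank is a cardinal (so no infinite cardinals are identified). For a commutative group all
  maximal independent subsets are equipotent, hence the choice of one of them is immaterial;
  \<open>maximal_Z_independent_exists\<close> shows that there is one to choose.\<close>

definition rational_rank :: "('a, 'b) monoid_scheme \<Rightarrow> 'a rel" where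
  "rational_rank G = |SOME S. maximal_Z_independent G S|"

lemma maximal_Z_independent_exists: "\<exists>S. maximal_Z_independent G S"
proof -
  let ?A = "{S. Z_independent G S}"
  have "\<exists>M \<in> {S. Z_independent G S}. \<forall>Y \<in> {S. Z_independent G S}. M \<subseteq> Y \<longrightarrow> Y = M"
  proof (rule subset_Zorn_nonempty)
    have "Z_independent G {}"
      by (simp add: Z_independent_def)
    then show "?A \<noteq> {}" by blast
  next
    fix C assume ne: "C \<noteq> {}" and chain: "subset.chain ?A C"
    have ind: "Z_independent G Y" if "Y \<in> C" for Y
      using chain that by (auto simp: subset.chain_def)
    have "Z_independent G (\<Union>C)"
      unfolding Z_independent_def
    proof (intro conjI allI impI)
      show "\<Union>C \<subseteq> carrier G"
        using ind by (auto simp: Z_independent_def)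
    next
      fix T and c :: "'a \<Rightarrow> int"
      assume T: "finite T" "T \<subseteq> \<Union>C"
        and one: "finprod G (\<lambda>x. x [^]\<^bsub>G\<^esub> c x) T = \<one>\<^bsub>G\<^esub>"
      obtain Y where "Y \<in> C" "T \<subseteq> Y"
        using finite_subset_Union_chain[OF T ne chain] by blast
      then show "\<forall>x\<in>T. c x = 0"
        using ind[of Y] T(1) one unfolding Z_independent_def by blast
    qed
    then show "\<Union>C \<in> ?A" by simp
  qed
  then show ?thesis
    unfolding maximal_Z_independent_def by blast
qed

end

(* If L*/K* has an element of infinite order, then, as [L : K] = 2, it is represented by some t with
   t^2 = t + d, d in K (divide by the trace, which is nonzero because the square is not in K), and
   the conjugate of t is 1 - t. All computations take place in Z[t], the quotient of Z[X] by a prime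
   ideal I. Suppose B_0, ..., B_(k-1) in Z[X] are given and let g be the product of 1 - 2X with all
   B_i(X) and B_i(1 - X). If B = X + a, with a invariant under X -> 1 - X, divides no power of g
   modulo I, then B(t) is independent of the B_i(t) modulo K*: comparing a multiplicative relation
   with its conjugate and reducing modulo B, where B(1 - X) = 1 - 2X, would make B divide a power
   of g. Such a B always exists: if t is transcendental over the prime field by a degree argument,
   if t is algebraic over Q by evaluating the minimal polynomial at a suitable integer; and t cannot
   be algebraic over a finite field, since it would then be a root of unity. Iterating gives
   infinitely many independent elements. *)

theory Submission
  imports Defs "HOL-Computational_Algebra.Polynomial"
begin

section \<open>Prime ideals of integer polynomials\<close>

abbreviation refl_poly :: "int poly \<Rightarrow> int poly" where
  "refl_poly P \<equiv> pcompose P [:1, -1:]"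

lemma refl_poly_refl_poly [simp]: "refl_poly (refl_poly P) = P"
proof -
  have "refl_poly (refl_poly P) = pcompose P (pcompose [:1, -1:] [:1, -1:])"
    by (rule pcompose_assoc[symmetric])
  also have "pcompose [:1, -1:] [:1, -1::int:] = [:0, 1:]"
    by (simp add: pcompose_pCons one_pCons)
  finally show ?thesis by simp
qed

lemma degree_refl_poly [simp]: "degree (refl_poly P) = degree P"
  by (simp add: degree_pcompose)

lemma abs_lead_coeff_refl_poly: "\<bar>lead_coeff (refl_poly P)\<bar> = \<bar>lead_coeff P\<bar>"
  using lead_coeff_comp[of "[:1, -1::int:]" P] by (simp add: abs_mult power_abs)

lemma refl_poly_power: "refl_poly (P ^ n) = refl_poly P ^ n"
  by (induction n) (simp_all add: pcompose_mult pcompose_1)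

text \<open>The constant term of \<open>f\<close> divides \<open>f a\<close> for \<open>a = m f(0) y\<close>, and the cofactor is coprime
  to \<open>m\<close>; so it would have to be \<open>\<plusminus>1\<close> for all \<open>y\<close>.\<close>
lemma poly_value_not_dvd_powers:
  fixes f :: "int poly" and m :: int
  assumes deg: "degree f > 0" and f0: "poly f 0 \<noteq> 0" and m: "m \<noteq> 0"
  shows "\<exists>a. \<forall>M. \<not> poly f a dvd m ^ M"
proof (rule ccontr)
  assume "\<not> ?thesis"
  then have all: "\<exists>M. poly f a dvd m ^ M" for a by blast
  let ?a = "\<lambda>y. m * poly f 0 * y"
  \<comment> \<open>If every value of \<open>f\<close> divided a power of \<open>m\<close>, this
    polynomial would vanish at infinitely many multiples of \<open>m * poly f 0\<close>, and
    \<open>f\<close> would be constant.\<close>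
  let ?h = "f ^ 2 - [:poly f 0 ^ 2:]"
  have "poly ?h (?a y) = 0" for y
  proof -
    obtain g where f_eq: "f = pCons (poly f 0) g"
      by (cases f) auto
    have eq: "poly f (?a y) = poly f 0 * (1 + m * (y * poly g (?a y)))"
      by (subst f_eq) (simp add: algebra_simps)
    obtain M where M: "poly f (?a y) dvd m ^ M" using all by blast
    let ?u = "1 + m * (y * poly g (?a y))"
    have "?u dvd m ^ M" using M unfolding eq by (rule dvd_mult_right)
    moreover have "coprime ?u (m ^ M)"
      by (metis coprime_power_right_iff coprime_1_left gcd_add_mult coprime_iff_gcd_eq_1
          add.commute gcd.commute mult.commute)
    ultimately have "is_unit ?u" using coprime_absorb_left by blast
    then have "?u ^ 2 = 1" by (metis power2_abs zdvd1_eq one_power2)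
    then show ?thesis by (simp add: eq power_mult_distrib)
  qed
  then have "range ?a \<subseteq> {x. poly ?h x = 0}" by blast
  moreover have "infinite (range ?a)"
    using m f0 infinite_UNIV_int by (auto simp: inj_on_def dest!: finite_imageD)
  ultimately have "?h = 0" using poly_roots_finite finite_subset by blast
  then have "f ^ 2 = [:poly f 0 ^ 2:]" by simp
  then have "degree (f ^ 2) = 0" by (simp only: degree_pCons_0)
  moreover have "f \<noteq> 0" using deg by auto
  ultimately show False using deg degree_power_eq[of f 2] by simp
qed

lemma finite_range_repeats:
  fixes f :: "nat \<Rightarrow> 'a"
  assumes "finite (range f)"
  obtains i j where "i < j" "f i = f j"
proof -
  have "\<not> inj f" using assms finite_imageD infinite_UNIV_nat by blast
  then show thesis using that by (metis injI linorder_neqE_nat)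
qed

lemma finite_small_polys:
  fixes q :: int
  shows "finite {R. degree R < d \<and> (\<forall>i. coeff R i \<in> {0..<q})}" (is "finite ?S")
proof -
  have "?S \<subseteq> Poly ` {xs. set xs \<subseteq> {0..<q} \<and> length xs = d}"
  proof
    fix R assume R: "R \<in> ?S"
    have "R = Poly (map (coeff R) [0..<d])"
      using R by (intro poly_eqI) (auto simp: nth_default_def intro: coeff_eq_0)
    moreover have "map (coeff R) [0..<d] \<in> {xs. set xs \<subseteq> {0..<q} \<and> length xs = d}"
      using R by auto
    ultimately show "R \<in> Poly ` {xs. set xs \<subseteq> {0..<q} \<and> length xs = d}" by blast
  qed
  then show ?thesis by (rule finite_subset) (simp add: finite_lists_length_eq)
qed

section \<open>Congruence modulo a prime ideal and leading coefficients\<close>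

locale poly_prime_ideal =
  fixes I :: "int poly set"
  assumes zero: "0 \<in> I" and add: "P \<in> I \<Longrightarrow> Q \<in> I \<Longrightarrow> P + Q \<in> I"
    and mult: "P \<in> I \<Longrightarrow> P * Q \<in> I" and one: "1 \<notin> I"
    and prime: "P * Q \<in> I \<Longrightarrow> P \<in> I \<or> Q \<in> I"
begin

lemma mult': "P \<in> I \<Longrightarrow> Q * P \<in> I"
  using mult[of P Q] by (simp add: mult.commute)

lemma uminus: "P \<in> I \<Longrightarrow> - P \<in> I"
  using mult[of P "-1"] by simp

lemma diff: "P \<in> I \<Longrightarrow> Q \<in> I \<Longrightarrow> P - Q \<in> I"
  using add[of P "- Q"] uminus by simp

lemma power_mem: "P ^ n \<in> I \<Longrightarrow> P \<in> I"
  by (induction n) (use one prime in auto)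

lemma cong_trans: "P - Q \<in> I \<Longrightarrow> Q - R \<in> I \<Longrightarrow> P - R \<in> I"
  using add[of "P - Q" "Q - R"] by simp

lemma cong_mult: "P - P' \<in> I \<Longrightarrow> Q - Q' \<in> I \<Longrightarrow> P * Q - P' * Q' \<in> I"
  using add[OF mult[of "P - P'" Q] mult'[of "Q - Q'" P']] by (simp add: algebra_simps)

lemma cong_power: "P - P' \<in> I \<Longrightarrow> P ^ n - P' ^ n \<in> I"
  by (induction n) (auto simp: zero intro: cong_mult)

text \<open>A leading term whose coefficient lies in \<open>I\<close> lies in \<open>I\<close>
  itself, so such terms are removed one by one. Recording that the difference has all its
  coefficients in \<open>I\<close> guarantees that \<open>P'\<close> is nonzero as soon as some
  coefficient of \<open>P\<close> is outside \<open>I\<close>.\<close>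

lemma cong_lead_coeff_notin:
  obtains P' where "P - P' \<in> I" "\<forall>i. [:coeff (P - P') i:] \<in> I" "P' = 0 \<or> [:lead_coeff P':] \<notin> I"
proof -
  have "\<exists>P'. P - P' \<in> I \<and> (\<forall>i. [:coeff (P - P') i:] \<in> I) \<and> (P' = 0 \<or> [:lead_coeff P':] \<notin> I)"
  proof (induction "degree P" arbitrary: P rule: less_induct)
    case less
    show ?case
    proof (cases "[:lead_coeff P:] \<in> I")
      case False
      then show ?thesis using zero by (intro exI[of _ P]) simp
    next
      case True
      let ?m = "monom (lead_coeff P) (degree P)"
      have m: "?m \<in> I" using mult[OF True, of "monom 1 (degree P)"] by (simp add: smult_monom)
      have m': "[:coeff ?m i:] \<in> I" for i using True zero by (cases "degree P = i") auto
      show ?thesis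
      proof (cases "P = ?m")
        case True
        with m m' show ?thesis by (intro exI[of _ 0]) auto
      next
        case False
        have "degree (P - ?m) < degree P"
          using False by (intro degree_less_if_less_eqI) (auto intro: degree_diff_le degree_monom_le)
        from less[OF this] obtain P' where P': "P - ?m - P' \<in> I"
          "\<And>i. [:coeff (P - ?m - P') i:] \<in> I" "P' = 0 \<or> [:lead_coeff P':] \<notin> I" by blast
        have eq: "P - P' = (P - ?m - P') + ?m" by simp
        have "P - P' \<in> I" unfolding eq by (rule add[OF P'(1) m])
        moreover have "[:coeff (P - P') i:] \<in> I" for i
        proof -
          have "[:coeff (P - P') i:] = [:coeff (P - ?m - P') i:] + [:coeff ?m i:]" by simp
          then show ?thesis using add[OF P'(2) m'] by (simp only:)
        qed
        ultimately show ?thesis using P'(3) by blast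
      qed
    qed
  qed
  then show thesis using that by blast
qed

section \<open>Elements transcendental over the prime field\<close>

text \<open>\<open>B = X u\<close> with \<open>u \<equiv> 1\<close> modulo \<open>g\<close>: if \<open>B\<close> divided a power of \<open>g\<close>, then \<open>u\<close> would be a unit,
  which its degree forbids. The factor \<open>refl_poly g\<close> makes \<open>B - X\<close> invariant under \<open>X \<mapsto> 1 - X\<close>.\<close>

lemma transcendental_case:
  assumes coeffs: "\<And>P i. P \<in> I \<Longrightarrow> [:coeff P i:] \<in> I" and g: "g \<notin> I"
  shows "\<exists>B. refl_poly B = B + [:1, -2:] \<and> (\<forall>N W. B * W - g ^ N \<notin> I)"
proof -
  \<comment> \<open>Replacing \<open>g\<close> by \<open>h\<close> makes degrees meaningful in the
    quotient: the leading coefficient no longer vanishes modulo \<open>I\<close>.\<close>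
  obtain h where gh: "g - h \<in> I" and "\<forall>i. [:coeff (g - h) i:] \<in> I" and h: "h = 0 \<or> [:lead_coeff h:] \<notin> I"
    by (rule cong_lead_coeff_notin[where P = g])
  have h0: "h \<noteq> 0" using gh g by auto
  with h have lc: "[:lead_coeff h:] \<notin> I" by blast
  have lc': "[:lead_coeff (refl_poly h):] \<notin> I"
  proof -
    have "lead_coeff (refl_poly h) = lead_coeff h \<or> lead_coeff (refl_poly h) = - lead_coeff h"
      using abs_lead_coeff_refl_poly[of h] by linarith
    then show ?thesis using lc uminus[of "[:- lead_coeff h:]"] by auto
  qed
  define v where "v = [:1, -1:] * (h * refl_poly h)"
  define u where "u = 1 + v"
  define B where "B = [:0, 1:] * u"
  have rh0: "refl_poly h \<noteq> 0" using h0 refl_poly_refl_poly[of h] by force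
  have degv: "degree v > 0" 
    unfolding v_def using h0 rh0 by (subst degree_mult_eq) auto
  have degu: "degree u = degree v" unfolding u_def using degv by (intro degree_add_eq_right) simp
  have lcu: "lead_coeff u = lead_coeff v" unfolding u_def using degv
    by (intro lead_coeff_add_le) simp
  have lcv: "lead_coeff v = - (lead_coeff h * lead_coeff (refl_poly h))"
    unfolding v_def by (simp only: lead_coeff_mult) simp
  have lcu_notin: "[:lead_coeff u:] \<notin> I"
  proof
    assume "[:lead_coeff u:] \<in> I"
    from uminus[OF this] have "[:lead_coeff h:] * [:lead_coeff (refl_poly h):] \<in> I"
      by (simp add: lcu lcv mult.commute)
    then show False using prime lc lc' by blast
  qed
  \<comment> \<open>Once \<open>W\<close> is reduced to \<open>V\<close>, the top coefficient of
    \<open>u * V - 1\<close> is the product of two leading coefficients outside \<open>I\<close>,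
    because subtracting 1 does not reach the positive top degree; yet \<open>coeffs\<close> puts it
    into \<open>I\<close>.\<close>
  have unit: False if W: "u * W - 1 \<in> I" for W
  proof -
    obtain V where WV: "W - V \<in> I" and "\<forall>i. [:coeff (W - V) i:] \<in> I" and V: "V = 0 \<or> [:lead_coeff V:] \<notin> I"
      by (rule cong_lead_coeff_notin[where P = W])
    have uV: "u * V - 1 \<in> I" using diff[OF W mult'[OF WV, of u]] by (simp add: algebra_simps)
    have V0: "V \<noteq> 0" using uV one uminus[of "-1"] by auto
    have u0: "u \<noteq> 0" using degu degv by auto
    have d: "degree (u * V) > 0" using u0 V0 degu degv by (simp add: degree_mult_eq)
    have "coeff (u * V - 1) (degree (u * V)) = lead_coeff u * lead_coeff V"
      using d by (simp add: lead_coeff_mult[symmetric] del: lead_coeff_mult)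
    then have "[:lead_coeff u:] * [:lead_coeff V:] \<in> I"
      using coeffs[OF uV, of "degree (u * V)"] by (simp add: mult.commute del: coeff_diff)
    then show False using prime lcu_notin V V0 by blast
  qed
  have "refl_poly B = B + [:1, -2:]"
  proof -
    have 1: "[:1, -1::int:] = 1 - [:0, 1:]" "[:1, -2::int:] = 1 - 2 * [:0, 1:]"
      by (simp_all add: one_pCons numeral_poly)
    have 2: "refl_poly [:0, 1:] = [:1, -1:]" "refl_poly [:1, -1:] = [:0, 1:]"
      by (simp_all add: pcompose_pCons)
    have "refl_poly B = [:1, -1:] * (1 + [:0, 1:] * (refl_poly h * h))"
      by (simp only: B_def u_def v_def pcompose_mult pcompose_add pcompose_1 2 refl_poly_refl_poly)
    then show ?thesis unfolding B_def u_def v_def 1 by (simp only: algebra_simps)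
  qed
  moreover have "B * W - g ^ N \<notin> I" for N W
  proof
    assume "B * W - g ^ N \<in> I"
    then have 1: "B * W - h ^ N \<in> I" using cong_trans cong_power[OF gh] by blast
    \<comment> \<open>Since \<open>h * ?z\<close> is -1 modulo \<open>u\<close>, multiplying
      \<open>B * W - h ^ N\<close> by \<open>(- ?z) ^ N\<close> turns the second term into -1 modulo
      \<open>u\<close> and makes \<open>u\<close> a unit modulo \<open>I\<close>.\<close>
    let ?z = "[:1, -1:] * refl_poly h"
    have u_z: "u - h * ?z = 1" by (simp add: u_def v_def algebra_simps)
    have "u dvd (u - h * ?z) ^ N - (- (h * ?z)) ^ N"
    proof -
      have "u - h * ?z - (- (h * ?z)) dvd (u - h * ?z) ^ N - (- (h * ?z)) ^ N"
        by (subst power_diff_sumr2) (rule dvd_triv_left)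
      then show ?thesis by simp
    qed
    then obtain Q where Q: "1 - (- (h * ?z)) ^ N = u * Q"
      unfolding u_z by (auto elim: dvdE)
    have "(- (h * ?z)) ^ N = h ^ N * (- ?z) ^ N"
      by (simp only: mult_minus_right[symmetric] power_mult_distrib)
    with Q have Q': "u * Q = 1 - h ^ N * (- ?z) ^ N" by simp
    have "(B * W - h ^ N) * (- ?z) ^ N = u * ([:0, 1:] * W * (- ?z) ^ N + Q) - 1"
      by (simp only: distrib_left Q' B_def) (simp only: algebra_simps)
    then have "u * ([:0, 1:] * W * (- ?z) ^ N + Q) - 1 \<in> I"
      using mult[OF 1, of "(- ?z) ^ N"] by (simp only:)
    then show False by (rule unit)
  qed
  ultimately show ?thesis by blast
qed

section \<open>Elements algebraic over a finite prime field\<close>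

lemma monic_of_char_pos:
  assumes f: "f \<in> I" "[:lead_coeff f:] \<notin> I" and q: "q > 0" "[:q:] \<in> I"
  shows "\<exists>h. h \<in> I \<and> degree h \<le> degree f \<and> coeff h (degree f) = 1"
proof -
  let ?c = "lead_coeff f"
  \<comment> \<open>The powers of \<open>?c\<close> repeat modulo \<open>q\<close>; as
    \<open>?c\<close> is not in \<open>I\<close>, cancelling the common power yields an inverse
    \<open>c'\<close> of \<open>?c\<close> modulo \<open>I\<close>.\<close>
  have "range (\<lambda>k::nat. ?c ^ k mod q) \<subseteq> {0..<q}" using q by auto
  then have "finite (range (\<lambda>k::nat. ?c ^ k mod q))" using finite_subset by blast
  from finite_range_repeats[OF this] obtain i j :: nat
    where ij: "i < j" "?c ^ i mod q = ?c ^ j mod q" by blast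
  from ij(2) obtain z where z: "?c ^ j - ?c ^ i = q * z" by (metis mod_eq_dvd_iff dvdE)
  have j: "j = i + Suc (j - i - 1)" using ij by simp
  define c' where "c' = ?c ^ (j - i - 1)"
  have "?c ^ j = ?c ^ i * (?c * c')" unfolding c'_def by (subst j) (simp only: power_add power_Suc)
  then have "[:?c:] ^ i * [:?c * c' - 1:] = [:q:] * [:z:]"
    using z by (simp add: poly_const_pow algebra_simps)
  then have "[:?c:] ^ i * [:?c * c' - 1:] \<in> I" using mult[OF q(2)] by metis
  then have c': "[:?c * c' - 1:] \<in> I" using prime power_mem f(2) by blast
  \<comment> \<open>The subtracted term corrects the coefficient \<open>?c * c'\<close> at
    \<open>degree f\<close> to exactly 1 without leaving \<open>I\<close>.\<close>
  let ?h = "f * [:c':] - [:?c * c' - 1:] * monom 1 (degree f)"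
  have "?h \<in> I" by (intro diff mult f c')
  moreover have "degree ?h \<le> degree f"
    by (intro degree_diff_le) (auto simp: smult_monom intro: degree_monom_le degree_smult_le order_trans)
  moreover have "coeff ?h (degree f) = 1" by (simp add: smult_monom algebra_simps)
  ultimately show ?thesis by blast
qed

text \<open>Modulo \<open>q\<close> and a monic element of \<open>I\<close> only finitely many
  residues remain, so two powers of X agree modulo \<open>I\<close>; the lower one cancels because
  \<open>I\<close> is prime and does not contain X.\<close>

lemma power_var_cong_one:
  assumes f: "f \<in> I" "[:lead_coeff f:] \<notin> I" and q: "q > 0" "[:q:] \<in> I" and X: "[:0, 1:] \<notin> I"
  shows "\<exists>n>0. [:0, 1:] ^ n - 1 \<in> I"
proof -
  define d where "d = degree f"
  obtain h where h: "h \<in> I" "degree h \<le> d" "coeff h d = 1"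
    using monic_of_char_pos[OF f q] d_def by blast
  have d: "d > 0"
  proof (rule ccontr)
    assume "\<not> d > 0"
    then have "f = [:lead_coeff f:]" unfolding d_def by (metis degree_eq_zeroE coeff_pCons_0 gr0I degree_pCons_0)
    then show False using f by metis
  qed
  \<comment> \<open>Division with remainder by \<open>h\<close> in Horner order: after
    multiplication by X a single subtraction clears the coefficient at \<open>d\<close>.\<close>
  have red1: "\<exists>R. P - R \<in> I \<and> degree R < d" for P
  proof (induction P)
    case 0
    then show ?case using d zero by (intro exI[of _ 0]) simp
  next
    case (pCons a P)
    then obtain R where R: "P - R \<in> I" "degree R < d" by blast
    let ?c = "coeff (pCons a R) d"
    let ?R = "pCons a R - h * [:?c:]"
    have "pCons a P - ?R = (P - R) * [:0, 1:] + h * [:?c:]" by simp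
    then have "pCons a P - ?R \<in> I" using add[OF mult[OF R(1)] mult[OF h(1)]] by metis
    moreover have "degree ?R < d"
    proof -
      have "degree ?R \<le> d"
        using R(2) h(2) degree_pCons_le[of a R] by (intro degree_diff_le) (auto intro: order_trans[OF degree_smult_le])
      moreover have "coeff ?R d = 0" using h(3) by simp
      ultimately show ?thesis using d by (metis degree_0 le_neq_implies_less leading_coeff_0_iff)
    qed
    ultimately show ?case by blast
  qed
  let ?S = "{R. degree R < d \<and> (\<forall>i. coeff R i \<in> {0..<q})}"
  have red2: "\<exists>R. P - R \<in> I \<and> R \<in> ?S" for P
  proof -
    obtain R where R: "P - R \<in> I" "degree R < d" using red1 by blast
    let ?R = "map_poly (\<lambda>c. c mod q) R"
    have "R - ?R = [:q:] * map_poly (\<lambda>c. c div q) R"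
      by (rule poly_eqI) (simp add: coeff_map_poly minus_mod_eq_mult_div)
    then have "R - ?R \<in> I" using mult[OF q(2)] by metis
    then have "P - ?R \<in> I" by (rule cong_trans[OF R(1)])
    moreover have "degree ?R < d" using R(2) map_poly_degree_leq order_le_less_trans by blast
    moreover have "coeff ?R i \<in> {0..<q}" for i using q(1) by (simp add: coeff_map_poly)
    ultimately show ?thesis by blast
  qed
  define rep where "rep P = (SOME R. P - R \<in> I \<and> R \<in> ?S)" for P
  have rep: "P - rep P \<in> I" "rep P \<in> ?S" for P
    using someI_ex[OF red2[of P]] unfolding rep_def by blast+
  have "finite (range (\<lambda>k::nat. rep ([:0, 1:] ^ k)))"
    by (rule finite_subset[OF _ finite_small_polys[of d q]]) (use rep(2) in auto)
  from finite_range_repeats[OF this] obtain i j :: nat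
    where ij: "i < j" "rep ([:0, 1:] ^ i) = rep ([:0, 1:] ^ j)" by blast
  have "[:0, 1:] ^ j - [:0, 1:] ^ i \<in> I"
    using diff[OF rep(1)[of "[:0, 1:] ^ j"] rep(1)[of "[:0, 1:] ^ i"]] ij(2) by simp
  moreover have "[:0, 1:] ^ j - [:0, 1:] ^ i = [:0, 1:] ^ i * ([:0, 1:] ^ (j - i) - 1::int poly)"
    using ij(1) by (simp only: right_diff_distrib power_add[symmetric] mult_1_right) simp
  ultimately have "[:0, 1:] ^ (j - i) - 1 \<in> I" using prime power_mem X by metis
  then show ?thesis using ij(1) by (intro exI[of _ "j - i"]) simp
qed

section \<open>Elements algebraic over the rationals\<close>

text \<open>For the minimal polynomial \<open>f\<close> and \<open>B = X - b\<close>, evaluation at \<open>b\<close> turns divisibility of a power of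
  \<open>g\<close> modulo \<open>I\<close> into divisibility of a power of a fixed integer by \<open>f(b)\<close>.\<close>

lemma algebraic_case:
  assumes const: "\<And>c. [:c:] \<in> I \<Longrightarrow> c = 0" and X: "[:0, 1:] \<notin> I"
    and f': "f' \<in> I" "f' \<noteq> 0" and g: "g \<notin> I"
  shows "\<exists>B. refl_poly B = B + [:1, -2:] \<and> (\<forall>N W. B * W - g ^ N \<notin> I)"
proof -
  \<comment> \<open>The leading coefficient of this minimal polynomial need not be 1, so the
    divisions below are pseudo-divisions, which cost powers of \<open>?c\<close>.\<close>
  obtain f where f: "f \<in> I" "f \<noteq> 0" and f_min: "\<And>h. h \<in> I \<Longrightarrow> h \<noteq> 0 \<Longrightarrow> degree f \<le> degree h"
    using ex_has_least_nat[of "\<lambda>h. h \<in> I \<and> h \<noteq> 0" f' degree] f' by blast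
  let ?c = "lead_coeff f"
  have c0: "?c \<noteq> 0" using f by simp
  have degf: "degree f > 0"
  proof (rule ccontr)
    assume "\<not> degree f > 0"
    then obtain c where "f = [:c:]" using degree_eq_zeroE by blast
    then show False using f const by auto
  qed
  have f0: "poly f 0 \<noteq> 0"
  proof
    assume "poly f 0 = 0"
    then obtain h where h: "f = [:0, 1:] * h" by (metis poly_eq_0_iff_dvd dvdE minus_zero)
    then have "h \<in> I" using f X prime[of "[:0, 1:]" h] by simp
    moreover have "h \<noteq> 0" using h f by auto
    moreover have "degree f = Suc (degree h)" unfolding h using \<open>h \<noteq> 0\<close> by simp
    ultimately show False using f_min by fastforce
  qed
  have const_mult: "P \<in> I" if "smult k P \<in> I" "k \<noteq> 0" for k P
    using prime[of "[:k:]" P] that const by auto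
  \<comment> \<open>The remainder lies in \<open>I\<close>, so if nonzero it would contradict the
    minimality of the degree of \<open>f\<close>.\<close>
  have div_f: "\<exists>e Q. smult (?c ^ e) P = f * Q" if P: "P \<in> I" for P
  proof -
    obtain Q R where QR: "pseudo_divmod P f = (Q, R)" by fastforce
    note * = pseudo_divmod[OF f(2) QR]
    have "R = smult (?c ^ (Suc (degree P) - degree f)) P - f * Q" using *(1) by simp
    then have "R \<in> I" using mult'[OF P, of "[:?c ^ (Suc (degree P) - degree f):]"] mult[OF f(1), of Q] diff
      by simp
    then have "R = 0" using *(2) f_min by fastforce
    then show ?thesis using *(1) by auto
  qed
  obtain W\<^sub>0 n where n: "n \<noteq> 0" and W\<^sub>0: "g * W\<^sub>0 - [:n:] \<in> I"
  proof -
    \<comment> \<open>Euclid's algorithm modulo \<open>I\<close>: among the residues of multiples of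
      \<open>g\<close> outside \<open>I\<close>, take \<open>r\<close> of least degree.
      Pseudo-division by \<open>f\<close> gives \<open>degree r < degree f\<close>. Pseudo-division
      of \<open>f\<close> by \<open>r\<close> leaves remainder 0, so the quotient lies in
      \<open>I\<close> and has degree at least that of \<open>f\<close>, which makes
      \<open>r\<close> constant.\<close>
    let ?J = "\<lambda>r. r \<notin> I \<and> (\<exists>W. g * W - r \<in> I)"
    have "?J g" using g zero by (auto intro!: exI[of _ 1])
    then obtain r where r: "r \<notin> I" "\<exists>W. g * W - r \<in> I"
      and r_min: "\<And>s. ?J s \<Longrightarrow> degree r \<le> degree s"
      using ex_has_least_nat[of ?J g degree] by blast
    then obtain W where W: "g * W - r \<in> I" by blast
    have r0: "r \<noteq> 0" using r zero by auto
    have "degree r < degree f"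
    proof -
      obtain Q s where Qs: "pseudo_divmod r f = (Q, s)" by fastforce
      note * = pseudo_divmod[OF f(2) Qs]
      let ?k = "?c ^ (Suc (degree r) - degree f)"
      have s: "s = smult ?k r - f * Q" using *(1) by simp
      have "s \<notin> I"
      proof
        assume "s \<in> I"
        then have "smult ?k r \<in> I" using add[OF _ mult[OF f(1)], of s Q] s by simp
        then show False using const_mult c0 r by simp
      qed
      moreover have "g * smult ?k W - s \<in> I"
        using add[OF mult'[OF W, of "[:?k:]"] mult[OF f(1), of Q]] by (simp add: s algebra_simps smult_diff_right)
      ultimately have "degree r \<le> degree s" using r_min by blast
      moreover have "s \<noteq> 0" using \<open>s \<notin> I\<close> zero by auto
      ultimately show ?thesis using *(2) by simp
    qed
    have "degree r = 0"
    proof (rule ccontr)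
      assume degr: "degree r \<noteq> 0"
      obtain Q s where Qs: "pseudo_divmod f r = (Q, s)" by fastforce
      note * = pseudo_divmod[OF r0 Qs]
      let ?k = "lead_coeff r ^ (Suc (degree f) - degree r)"
      have k0: "?k \<noteq> 0" using r0 by simp
      have s: "s = smult ?k f - r * Q" using *(1) by simp
      have kf: "smult ?k f \<in> I" using mult'[OF f(1), of "[:?k:]"] by simp
      have gs: "g * (- W * Q) - s \<in> I"
        using diff[OF uminus[OF mult[OF W, of Q]] kf] by (simp add: s algebra_simps)
      have "s \<in> I"
      proof (rule ccontr)
        assume "s \<notin> I"
        then have "degree r \<le> degree s" "s \<noteq> 0" using r_min[of s] gs zero by blast+
        then show False using *(2) by auto
      qed
      moreover have "s = 0 \<or> degree s < degree f" using *(2) \<open>degree r < degree f\<close> by auto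
      ultimately have "s = 0" using f_min by fastforce
      then have rQ: "r * Q = smult ?k f" using s by simp
      then have "Q \<in> I" using kf prime[of r Q] r by simp
      moreover have "Q \<noteq> 0" using rQ k0 f by auto
      ultimately have "degree f \<le> degree Q" using f_min by blast
      moreover have "degree r + degree Q = degree f"
        using arg_cong[OF rQ, of degree] r0 \<open>Q \<noteq> 0\<close> k0 by (simp add: degree_mult_eq)
      ultimately show False using degr by simp
    qed
    then obtain n where "r = [:n:]" by (rule degree_eq_zeroE)
    with that W r0 show thesis by auto
  qed
  \<comment> \<open>The factor \<open>n\<close> comes from inverting \<open>g\<close>, the factor
    \<open>?c\<close> from the pseudo-division in \<open>div_f\<close>.\<close>
  obtain b where b: "\<And>M. \<not> poly f b dvd (n * ?c) ^ M"
    using poly_value_not_dvd_powers[OF degf f0, of "n * ?c"] n c0 by auto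
  let ?B = "[:- b, 1:]"
  have "refl_poly ?B = ?B + [:1, -2:]" by (simp add: pcompose_pCons)
  moreover have "?B * W - g ^ N \<notin> I" for N W
  proof
    assume BW: "?B * W - g ^ N \<in> I"
    \<comment> \<open>Multiplying by the \<open>N\<close>-th power of the cofactor of
      \<open>g\<close> trades \<open>g ^ N\<close> for a constant, which evaluation at
      \<open>b\<close> leaves unchanged.\<close>
    have "?B * (W * W\<^sub>0 ^ N) - [:n:] ^ N
        = (?B * W - g ^ N) * W\<^sub>0 ^ N + ((g * W\<^sub>0) ^ N - [:n:] ^ N)"
      by (simp only: power_mult_distrib left_diff_distrib mult.assoc)
    then have "?B * (W * W\<^sub>0 ^ N) - [:n:] ^ N \<in> I"
      using add[OF mult[OF BW] cong_power[OF W\<^sub>0]] by metis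
    from div_f[OF this] obtain e Q where
      eQ: "smult (?c ^ e) (?B * (W * W\<^sub>0 ^ N) - [:n:] ^ N) = f * Q" by blast
    have "poly (smult (?c ^ e) (?B * (W * W\<^sub>0 ^ N) - [:n:] ^ N)) b = - (?c ^ e * n ^ N)"
      by simp
    then have "poly f b dvd ?c ^ e * n ^ N" unfolding eQ
      by (metis dvd_minus_iff dvd_triv_left poly_mult)
    also have "\<dots> dvd (n * ?c) ^ (e + N)"
      by (simp add: power_add power_mult_distrib)
    finally show False using b by blast
  qed
  ultimately show ?thesis by blast
qed

text \<open>If membership in \<open>I\<close> is decided coefficientwise, the class of X is
  transcendental over the prime field. Otherwise it is algebraic, and a nonzero constant in
  \<open>I\<close> would make it a root of unity, against \<open>pow\<close>; so it is algebraic
  over the rationals.\<close>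

lemma avoid_powers:
  assumes X: "[:0, 1:] \<notin> I" and pow: "\<And>n. n > 0 \<Longrightarrow> [:0, 1:] ^ n - 1 \<notin> I" and g: "g \<notin> I"
  shows "\<exists>B. refl_poly B = B + [:1, -2:] \<and> (\<forall>N W. B * W - g ^ N \<notin> I)"
proof (cases "\<forall>P\<in>I. \<forall>i. [:coeff P i:] \<in> I")
  case True
  then show ?thesis using transcendental_case g by blast
next
  case False
  then obtain P i where P: "P \<in> I" "[:coeff P i:] \<notin> I" by blast
  obtain f where f: "P - f \<in> I" "\<forall>i. [:coeff (P - f) i:] \<in> I" "f = 0 \<or> [:lead_coeff f:] \<notin> I"
    by (rule cong_lead_coeff_notin[where P = P])
  have "f \<noteq> 0" using f(2) P(2) by auto
  then have lc: "[:lead_coeff f:] \<notin> I" using f(3) by blast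
  have fI: "f \<in> I" using diff[OF P(1) f(1)] by simp
  have "c = 0" if "[:c:] \<in> I" for c
  proof (rule ccontr)
    assume "c \<noteq> 0"
    have "[:\<bar>c\<bar>:] \<in> I" using that uminus[OF that] by (auto simp: abs_if)
    moreover have "\<bar>c\<bar> > 0" using \<open>c \<noteq> 0\<close> by simp
    ultimately show False using power_var_cong_one[OF fI lc _ _ X] pow by blast
  qed
  then show ?thesis using algebraic_case[OF _ X fI \<open>f \<noteq> 0\<close> g] by blast
qed

section \<open>Iterated choice of independent polynomials\<close>

text \<open>Modulo \<open>B\<close> the polynomial \<open>refl_poly B\<close> is \<open>1 - 2X\<close>, so membership in \<open>I\<close> would make \<open>B\<close> divide a
  power of \<open>g\<close>.\<close>

lemma cross_product_notin:
  assumes B: "refl_poly B = B + [:1, -2:]" "\<And>N W. B * W - g ^ N \<notin> I"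
    and g: "[:1, -2:] dvd g" "refl_poly g dvd g"
    and P: "P dvd g ^ a" and M: "M dvd g ^ b"
  shows "B ^ Suc n * P * refl_poly M - refl_poly (B ^ Suc n * P) * M \<notin> I"
proof
  let ?d = "[:1, -2::int:]"
  assume *: "B ^ Suc n * P * refl_poly M - refl_poly (B ^ Suc n * P) * M \<in> I"
  have "refl_poly P dvd refl_poly (g ^ a)"
    using P by (auto elim!: dvdE simp: pcompose_mult)
  also have "\<dots> dvd g ^ a" unfolding refl_poly_power using g(2) by (rule dvd_power_same)
  finally have P': "refl_poly P dvd g ^ a" .
  \<comment> \<open>Modulo \<open>B\<close> the first product in \<open>*\<close> vanishes and the
    second becomes this one; since it divides a power of \<open>g\<close>, the relation
    \<open>*\<close> turns into a congruence that the choice of \<open>B\<close> excludes.\<close>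
  have "?d ^ Suc n * refl_poly P * M dvd g ^ Suc n * g ^ a * g ^ b"
    by (intro mult_dvd_mono dvd_power_same g P' M)
  then obtain V where V: "g ^ (Suc n + a + b) = ?d ^ Suc n * refl_poly P * M * V"
    by (auto simp only: power_add elim!: dvdE)
  have "B dvd (B + ?d) ^ Suc n - ?d ^ Suc n"
  proof -
    have "B + ?d - ?d dvd (B + ?d) ^ Suc n - ?d ^ Suc n"
      by (subst power_diff_sumr2) (rule dvd_triv_left)
    then show ?thesis by (simp only: add_diff_cancel_right')
  qed
  then obtain Q where "(B + ?d) ^ Suc n - ?d ^ Suc n = B * Q" by (rule dvdE)
  then have Q: "?d ^ Suc n = (B + ?d) ^ Suc n - B * Q" by (simp only: algebra_simps)
  have refl: "refl_poly (B ^ Suc n * P) = (B + ?d) ^ Suc n * refl_poly P"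
    by (simp only: pcompose_mult refl_poly_power B(1))
  let ?W = "(B ^ n * P * refl_poly M - Q * refl_poly P * M) * V"
  have "B * ?W - g ^ (Suc n + a + b)
    = (B ^ Suc n * P * refl_poly M - refl_poly (B ^ Suc n * P) * M) * V"
    unfolding V Q refl by (simp only: algebra_simps power_Suc)
  then have "B * ?W - g ^ (Suc n + a + b) \<in> I" using mult[OF *, of V] by (simp only:)
  then show False using B(2) by blast
qed

text \<open>Each \<open>D k\<close> consists of the divisors of powers of \<open>G k\<close>, the
  product of 1 - 2X with the earlier polynomials \<open>B i\<close> and their reflections. The last
  property says that a positive power of \<open>B k\<close> times a quotient of elements of
  \<open>D k\<close> never equals its own conjugate.\<close>

lemma exists_independent_polys:
  assumes X: "[:0, 1:] \<notin> I" and pow: "\<And>n. n > 0 \<Longrightarrow> [:0, 1:] ^ n - 1 \<notin> I"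
    and refl: "\<And>P. P \<in> I \<Longrightarrow> refl_poly P \<in> I" and d: "[:1, -2:] \<notin> I"
  obtains B D where "\<And>k. B k \<notin> I" "\<And>k. B k \<in> D (Suc k)" "\<And>k. 1 \<in> D k" "\<And>k. D k \<subseteq> D (Suc k)"
    "\<And>k P Q. P \<in> D k \<Longrightarrow> Q \<in> D k \<Longrightarrow> P * Q \<in> D k" "\<And>k P. P \<in> D k \<Longrightarrow> P \<notin> I"
    "\<And>k n P M. P \<in> D k \<Longrightarrow> M \<in> D k \<Longrightarrow>
       B k ^ Suc n * P * refl_poly M - refl_poly (B k ^ Suc n * P) * M \<notin> I"
proof -
  define pick where "pick g = (SOME B. refl_poly B = B + [:1, -2:] \<and> (\<forall>N W. B * W - g ^ N \<notin> I))" for g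
  have pick: "refl_poly (pick g) = pick g + [:1, -2:]" "\<And>N W. pick g * W - g ^ N \<notin> I" if "g \<notin> I" for g
    using someI_ex[OF avoid_powers[OF X pow that]] unfolding pick_def by blast+
  \<comment> \<open>The initial factor 1 - 2X is what \<open>refl_poly B\<close> becomes modulo
    \<open>B\<close>, so its powers must divide powers of every \<open>G k\<close>.\<close>
  define G where "G = rec_nat [:1, -2:] (\<lambda>k g. g * pick g * refl_poly (pick g))"
  have G0: "G 0 = [:1, -2:]" and G_Suc: "G (Suc k) = G k * pick (G k) * refl_poly (pick (G k))" for k
    by (simp_all add: G_def)
  have pick_notin: "pick g \<notin> I" if "g \<notin> I" for g
  proof
    assume "pick g \<in> I"
    from diff[OF refl[OF this] this] show False using pick(1)[OF that] d by simp
  qed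
  have G: "G k \<notin> I" for k
  proof (induction k)
    case (Suc k)
    have "refl_poly (pick (G k)) \<notin> I" using refl pick_notin[OF Suc] by fastforce
    then show ?case using Suc pick_notin prime unfolding G_Suc by blast
  qed (simp add: G0 d)
  have d_dvd: "[:1, -2:] dvd G k" for k
  proof (induction k)
    case 0
    show ?case unfolding G0 by (rule dvd_refl)
  next
    case (Suc k)
    then show ?case unfolding G_Suc by (intro dvd_mult2)
  qed
  have G_refl: "refl_poly (G k) dvd G k" for k
  proof (induction k)
    case 0
    have "refl_poly [:1, -2:] = - [:1, -2:]" by (simp add: pcompose_pCons)
    then show ?case unfolding G0 by (simp only: minus_dvd_iff dvd_refl)
  next
    case (Suc k)
    have "refl_poly (G (Suc k)) = refl_poly (G k) * (pick (G k) * refl_poly (pick (G k)))"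
      by (simp only: G_Suc pcompose_mult refl_poly_refl_poly mult_ac)
    with Suc show ?case unfolding G_Suc mult.assoc by (simp only: mult_dvd_mono dvd_refl)
  qed
  define D where "D k = {P. \<exists>N. P dvd G k ^ N}" for k
  show thesis
  proof (rule that[of "\<lambda>k. pick (G k)" D])
    show "pick (G k) \<notin> I" for k using pick_notin G by blast
    show "pick (G k) \<in> D (Suc k)" for k
    proof -
      have "pick (G k) dvd G (Suc k) ^ 1" unfolding G_Suc by (simp only: power_one_right) (intro dvd_mult2 dvd_triv_right)
      then show ?thesis unfolding D_def by blast
    qed
    show "1 \<in> D k" for k unfolding D_def by auto
    show "D k \<subseteq> D (Suc k)" for k
    proof
      fix P assume "P \<in> D k"
      then obtain N where "P dvd G k ^ N" unfolding D_def by blast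
      then have "P dvd G (Suc k) ^ N" unfolding G_Suc power_mult_distrib by (intro dvd_mult2)
      then show "P \<in> D (Suc k)" unfolding D_def by blast
    qed
    show "P * Q \<in> D k" if PQ: "P \<in> D k" "Q \<in> D k" for k P Q
    proof -
      obtain a b where "P dvd G k ^ a" "Q dvd G k ^ b" using PQ unfolding D_def by blast
      then have "P * Q dvd G k ^ (a + b)" unfolding power_add by (rule mult_dvd_mono)
      then show ?thesis unfolding D_def by blast
    qed
    show "P \<notin> I" if "P \<in> D k" for k P
    proof
      assume "P \<in> I"
      obtain a Q where "G k ^ a = P * Q" using \<open>P \<in> D k\<close> unfolding D_def dvd_def by blast
      then have "G k ^ a \<in> I" using mult[OF \<open>P \<in> I\<close>, of Q] by (simp only:)
      then show False using power_mem G by blast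
    qed
    show "pick (G k) ^ Suc n * P * refl_poly M - refl_poly (pick (G k) ^ Suc n * P) * M \<notin> I"
      if "P \<in> D k" "M \<in> D k" for k n P M
      using that cross_product_notin[OF pick[OF G] d_dvd G_refl] unfolding D_def by blast
  qed
qed

end

section \<open>Independence in commutative groups\<close>

text \<open>Gaussian elimination by cross-multiplication instead of division: an equation with a
  nonzero entry eliminates one unknown, and the counts of equations and unknowns both drop by
  one.\<close>

lemma nontrivial_int_solution:
  fixes M :: "'a \<Rightarrow> 's \<Rightarrow> int"
  assumes "finite S" "finite I" "card S < card I"
  shows "\<exists>c. (\<exists>i\<in>I. c i \<noteq> 0) \<and> (\<forall>s\<in>S. (\<Sum>i\<in>I. c i * M i s) = 0)"
  using assms
proof (induction S arbitrary: I M rule: finite_induct)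
  case empty
  then show ?case by (intro exI[of _ "\<lambda>_. 1"]) (auto simp: card_gt_0_iff)
next
  case (insert s S)
  have fin: "finite I" by fact
  show ?case
  proof (cases "\<forall>i\<in>I. M i s = 0")
    case True
    have "card S < card I" using insert by simp
    from insert.IH[OF fin this] obtain c
      where c: "\<exists>i\<in>I. c i \<noteq> 0" "\<forall>s\<in>S. (\<Sum>i\<in>I. c i * M i s) = 0" by blast
    then show ?thesis using True by (intro exI[of _ c]) simp
  next
    case False
    then obtain j where j: "j \<in> I" "M j s \<noteq> 0" by blast
    define M' where "M' i r = M j s * M i r - M i s * M j r" for i r
    have "card S < card (I - {j})" using insert j fin by simp
    with insert.IH[of "I - {j}" M'] fin obtain c
      where c: "\<exists>i\<in>I - {j}. c i \<noteq> 0" "\<And>r. r \<in> S \<Longrightarrow> (\<Sum>i\<in>I - {j}. c i * M' i r) = 0" by auto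
    \<comment> \<open>Scaling the other unknowns by the pivot \<open>M j s\<close> leaves an
      integral value for the unknown \<open>j\<close> that solves equation \<open>s\<close>.\<close>
    define c' where "c' i = (if i = j then - (\<Sum>i\<in>I - {j}. c i * M i s) else M j s * c i)" for i
    have sum: "(\<Sum>i\<in>I. c' i * M i r) = (\<Sum>i\<in>I - {j}. c i * M' i r)" for r
    proof -
      have "(\<Sum>i\<in>I. c' i * M i r) = c' j * M j r + (\<Sum>i\<in>I - {j}. c' i * M i r)"
        using fin j by (simp add: sum.remove)
      also have "(\<Sum>i\<in>I - {j}. c' i * M i r) = (\<Sum>i\<in>I - {j}. M j s * c i * M i r)"
        by (rule sum.cong) (auto simp: c'_def)
      finally show ?thesis
        by (simp add: c'_def M'_def algebra_simps sum_subtractf sum_distrib_left)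
    qed
    have "(\<Sum>i\<in>I. c' i * M i r) = 0" if "r \<in> insert s S" for r
      unfolding sum using that c(2) by (auto simp: M'_def)
    moreover have "\<exists>i\<in>I. c' i \<noteq> 0" using c(1) j by (auto simp: c'_def)
    ultimately show ?thesis by blast
  qed
qed

section \<open>Multiplicative relations and rank\<close>

context comm_group
begin

lemma finprod_int_pow:
  fixes n :: int
  assumes "f \<in> A \<rightarrow> carrier G"
  shows "finprod G f A [^] n = finprod G (\<lambda>x. f x [^] n) A"
  using assms
proof (induction A rule: infinite_finite_induct)
  case (insert x A)
  then show ?case by (simp add: int_pow_distrib Pi_def)
qed simp_all

lemma finprod_finprod_int_pow:
  fixes e :: "'i \<Rightarrow> 'a \<Rightarrow> int" and c :: "'i \<Rightarrow> int"
  assumes "finite I" "finite S" "S \<subseteq> carrier G"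
  shows "finprod G (\<lambda>i. finprod G (\<lambda>s. s [^] e i s) S [^] c i) I
    = finprod G (\<lambda>s. s [^] (\<Sum>i\<in>I. c i * e i s)) S"
  using assms(1)
proof (induction I rule: finite_induct)
  case empty
  then show ?case by simp
next
  case (insert i I)
  have S: "s \<in> carrier G" if "s \<in> S" for s using that assms by blast
  have "finprod G (\<lambda>i. finprod G (\<lambda>s. s [^] e i s) S [^] c i) (insert i I)
    = finprod G (\<lambda>s. s [^] e i s) S [^] c i \<otimes> finprod G (\<lambda>s. s [^] (\<Sum>i\<in>I. c i * e i s)) S"
    using insert S by (subst finprod_insert) (auto intro!: finprod_closed int_pow_closed)
  also have "finprod G (\<lambda>s. s [^] e i s) S [^] c i = finprod G (\<lambda>s. s [^] (c i * e i s)) S"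
    using S by (subst finprod_int_pow) (auto simp: int_pow_pow mult.commute intro!: finprod_cong')
  also have "\<dots> \<otimes> finprod G (\<lambda>s. s [^] (\<Sum>i\<in>I. c i * e i s)) S
    = finprod G (\<lambda>s. s [^] (c i * e i s) \<otimes> s [^] (\<Sum>i\<in>I. c i * e i s)) S"
    using S by (intro finprod_multf[symmetric]) auto
  also have "\<dots> = finprod G (\<lambda>s. s [^] (\<Sum>i\<in>insert i I. c i * e i s)) S"
    using S insert by (intro finprod_cong') (auto simp: int_pow_mult)
  finally show ?case .
qed

text \<open>A maximal independent set generates the group up to torsion: adding a new
  \<open>x\<close> creates a relation, its exponent at \<open>x\<close> is nonzero because
  \<open>S\<close> is independent, and the relation is solved for that power of
  \<open>x\<close>.\<close>

lemma maximal_Z_independent_power: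
  assumes max: "maximal_Z_independent G S" and fin: "finite S" and x: "x \<in> carrier G"
  shows "\<exists>(n::int) e. n \<noteq> 0 \<and> x [^] n = finprod G (\<lambda>s. s [^] (e s :: int)) S"
proof (cases "x \<in> S")
  case True
  have ind: "Z_independent G S" using max by (simp add: maximal_Z_independent_def)
  then have S: "S \<subseteq> carrier G" by (simp add: Z_independent_def)
  have "finprod G (\<lambda>s. s [^] (if x = s then 1 else 0 :: int)) S
      = finprod G (\<lambda>s. if x = s then s else \<one>) S"
    using S by (intro finprod_cong') (auto simp: int_pow_1)
  also have "\<dots> = x" using finprod_singleton[OF True fin, of "\<lambda>s. s"] S by auto
  finally show ?thesis using x
    by (intro exI[of _ 1] exI[of _ "\<lambda>s. if x = s then 1 else 0"]) (simp add: int_pow_1)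
next
  case False
  have ind: "Z_independent G S" using max by (simp add: maximal_Z_independent_def)
  then have S: "S \<subseteq> carrier G" by (simp add: Z_independent_def)
  have "\<not> Z_independent G (insert x S)"
    using max False unfolding maximal_Z_independent_def by blast
  then obtain T and c :: "'a \<Rightarrow> int" and y where T: "finite T" "T \<subseteq> insert x S"
    and one: "finprod G (\<lambda>x. x [^] c x) T = \<one>" and y: "y \<in> T" "c y \<noteq> 0"
    using x S unfolding Z_independent_def by auto
  have no_rel: "c z = 0" if "finprod G (\<lambda>x. x [^] c x) T' = \<one>" "T' \<subseteq> S" "finite T'" "z \<in> T'" for T' z
    using ind that unfolding Z_independent_def by blast
  have T_carrier: "T \<subseteq> carrier G" using T x S by blast
  have xT: "x \<in> T" using no_rel[OF one _ T(1) y(1)] y T by blast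
  let ?T = "T - {x}"
  have T': "?T \<subseteq> S" "finite ?T" using T by auto
  have split: "x [^] c x \<otimes> finprod G (\<lambda>x. x [^] c x) ?T = \<one>"
  proof -
    have "finprod G (\<lambda>x. x [^] c x) (insert x ?T) = x [^] c x \<otimes> finprod G (\<lambda>x. x [^] c x) ?T"
      using T' T_carrier x by (intro finprod_insert) (auto intro!: int_pow_closed)
    then show ?thesis using xT one by (simp add: insert_absorb)
  qed
  have rest: "finprod G (\<lambda>x. x [^] c x) ?T \<in> carrier G"
    using T_carrier by (intro finprod_closed) auto
  have cx: "c x \<noteq> 0"
  proof
    assume "c x = 0"
    with split rest have "finprod G (\<lambda>x. x [^] c x) ?T = \<one>" by simp
    then show False using no_rel[of ?T y] T' y \<open>c x = 0\<close> by auto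
  qed
  \<comment> \<open>Solving for the power of \<open>x\<close> negates the exponents; elements of
    \<open>S\<close> outside the relation get exponent 0.\<close>
  define e where "e s = (if s \<in> T then - c s else 0)" for s
  have "x [^] c x = inv (finprod G (\<lambda>x. x [^] c x) ?T)"
    using split rest x by (metis inv_equality int_pow_closed)
  also have "\<dots> = finprod G (\<lambda>x. x [^] c x) ?T [^] (- 1 :: int)"
    using rest by (simp add: int_pow_neg int_pow_1)
  also have "\<dots> = finprod G (\<lambda>s. s [^] e s) ?T"
    using T_carrier by (subst finprod_int_pow) (auto simp: int_pow_pow e_def intro!: finprod_cong')
  also have "\<dots> = finprod G (\<lambda>s. s [^] e s) S"
    using T' fin S False by (intro finprod_mono_neutral_cong_left) (auto simp: e_def)
  finally show ?thesis using cx by blast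
qed

text \<open>If \<open>S\<close> were finite, nonzero powers of \<open>card S + 1\<close> members of
  \<open>b\<close> would be products of powers of \<open>S\<close>, and their exponent vectors,
  being too many, would yield a nontrivial relation. The hypothesis \<open>ind\<close> concerns only
  the last exponent, matching a construction that adds one element at a time.\<close>

lemma infinite_maximal_Z_independent:
  fixes b :: "nat \<Rightarrow> 'a"
  assumes max: "maximal_Z_independent G S" and b: "\<And>i. b i \<in> carrier G"
    and ind: "\<And>(c :: nat \<Rightarrow> int) k. finprod G (\<lambda>i. b i [^] c i) {..<Suc k} = \<one> \<Longrightarrow> c k = 0"
  shows "infinite S"
proof
  assume fin: "finite S"
  have S: "S \<subseteq> carrier G" using max by (simp add: maximal_Z_independent_def Z_independent_def)
  \<comment> \<open>A vanishing last factor can be deleted, so induction on the length makes all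
    exponents vanish.\<close>
  have ind': "\<forall>i<k. c i = 0" if "finprod G (\<lambda>i. b i [^] c i) {..<k} = \<one>" for c :: "nat \<Rightarrow> int" and k
    using that
  proof (induction k)
    case (Suc k)
    have "c k = 0" using ind Suc.prems by blast
    moreover from this have "finprod G (\<lambda>i. b i [^] c i) {..<k} = \<one>"
      using Suc.prems b by (simp add: lessThan_Suc finprod_closed)
    ultimately show ?case using Suc.IH less_Suc_eq by simp
  qed simp
  have "\<forall>i. \<exists>(n::int) e. n \<noteq> 0 \<and> b i [^] n = finprod G (\<lambda>s. s [^] (e s :: int)) S"
    using maximal_Z_independent_power[OF max fin b] by blast
  then obtain n :: "nat \<Rightarrow> int" and e where n: "\<And>i. n i \<noteq> 0"
    and e: "\<And>i. b i [^] n i = finprod G (\<lambda>s. s [^] (e i s :: int)) S" by metis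
  let ?I = "{..<Suc (card S)}"
  obtain c where c: "\<exists>i\<in>?I. c i \<noteq> 0" "\<forall>s\<in>S. (\<Sum>i\<in>?I. c i * e i s) = 0"
    using nontrivial_int_solution[OF fin, of ?I e] by auto
  have "finprod G (\<lambda>i. b i [^] (n i * c i)) ?I = finprod G (\<lambda>i. (b i [^] n i) [^] c i) ?I"
    using b by (intro finprod_cong') (auto simp: int_pow_pow)
  also have "\<dots> = finprod G (\<lambda>s. s [^] (\<Sum>i\<in>?I. c i * e i s)) S"
    unfolding e using finprod_finprod_int_pow[OF _ fin S, of ?I] by simp
  also have "\<dots> = finprod G (\<lambda>s. \<one>) S"
    using c(2) S by (intro finprod_cong') auto
  finally have "finprod G (\<lambda>i. b i [^] (n i * c i)) ?I = \<one>" by simp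
  from ind'[OF this] c(1) n show False by auto
qed

end

text \<open>Sorting the factors before the last one by the sign of their exponents writes their
  product as a quotient of \<open>\<phi> P\<close> by \<open>\<phi> M\<close> with \<open>P\<close>
  and \<open>M\<close> in \<open>D k\<close>. A nonzero last exponent then gives an equality that
  \<open>neq\<close> excludes.\<close>

lemma (in comm_group) last_exponent_zero:
  fixes B :: "nat \<Rightarrow> 'r :: comm_ring_1" and \<phi> :: "'r \<Rightarrow> 'a" and c :: "nat \<Rightarrow> int"
  assumes B: "\<And>k. B k \<in> D (Suc k)" and D: "\<And>k. 1 \<in> D k" "\<And>k. D k \<subseteq> D (Suc k)"
    "\<And>k P Q. P \<in> D k \<Longrightarrow> Q \<in> D k \<Longrightarrow> P * Q \<in> D k"
    and \<phi>: "\<And>k P. P \<in> D k \<Longrightarrow> \<phi> P \<in> carrier G" "\<phi> 1 = \<one>"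
    "\<And>k P Q. P \<in> D k \<Longrightarrow> Q \<in> D k \<Longrightarrow> \<phi> (P * Q) = \<phi> P \<otimes> \<phi> Q"
    and neq: "\<And>k n P M. P \<in> D k \<Longrightarrow> M \<in> D k \<Longrightarrow> n > 0 \<Longrightarrow> \<phi> (B k ^ n * P) \<noteq> \<phi> M"
    and rel: "finprod G (\<lambda>i. \<phi> (B i) [^] c i) {..<Suc k} = \<one>"
  shows "c k = 0"
proof -
  have \<phi>B: "\<phi> (B i) \<in> carrier G" for i using \<phi>(1) B by blast
  have pow_D: "B k ^ n \<in> D (Suc k)" for k n
    by (induction n) (simp_all add: D B)
  have \<phi>_pow: "\<phi> (B k ^ n * P) = \<phi> (B k) [^] n \<otimes> \<phi> P" if P: "P \<in> D k" for k n P
  proof (induction n)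
    case (Suc n)
    have "B k ^ n * P \<in> D (Suc k)" using pow_D D P by blast
    then have "\<phi> (B k ^ Suc n * P) = \<phi> (B k) \<otimes> \<phi> (B k ^ n * P)"
      unfolding power_Suc mult.assoc by (rule \<phi>(3)[OF B])
    also have "\<dots> = \<phi> (B k) [^] Suc n \<otimes> \<phi> P"
      unfolding Suc.IH using \<phi>(1)[OF P] \<phi>B[of k] by (simp add: m_ac)
    finally show ?case .
  qed (use \<phi>(1)[OF that] in simp)
  define prd where "prd m = finprod G (\<lambda>i. \<phi> (B i) [^] c i) {..<m}" for m
  have prd_0: "prd 0 = \<one>" by (simp add: prd_def)
  have prd_closed: "prd m \<in> carrier G" for m
    unfolding prd_def using \<phi>B by (intro finprod_closed) auto
  have prd_Suc: "prd (Suc m) = \<phi> (B m) [^] c m \<otimes> prd m" for m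
    unfolding prd_def lessThan_Suc using \<phi>B by (intro finprod_insert) auto
  have frac: "\<exists>P\<in>D m. \<exists>M\<in>D m. prd m \<otimes> \<phi> M = \<phi> P" for m
  proof (induction m)
    case 0
    show ?case using D(1) \<phi>(2) prd_0 by (intro bexI[of _ 1]) simp_all
  next
    case (Suc m)
    then obtain P M where PM: "P \<in> D m" "M \<in> D m" and eq: "prd m \<otimes> \<phi> M = \<phi> P" by blast
    note car = \<phi>B[of m] prd_closed[of m] \<phi>(1)[OF PM(1)] \<phi>(1)[OF PM(2)]
    show ?case
    proof (cases "c m \<ge> 0")
      case True
      have pow: "\<phi> (B m) [^] c m = \<phi> (B m) [^] nat (c m)"
        using int_pow_int[of G "\<phi> (B m)" "nat (c m)"] True by simp
      have "prd (Suc m) \<otimes> \<phi> M = \<phi> (B m) [^] nat (c m) \<otimes> (prd m \<otimes> \<phi> M)"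
        unfolding prd_Suc pow using car by (simp add: m_assoc)
      also have "\<dots> = \<phi> (B m ^ nat (c m) * P)" by (simp only: \<phi>_pow[OF PM(1)] eq)
      finally have *: "prd (Suc m) \<otimes> \<phi> M = \<phi> (B m ^ nat (c m) * P)" .
      have "B m ^ nat (c m) * P \<in> D (Suc m)" "M \<in> D (Suc m)" using PM pow_D D by blast+
      with * show ?thesis by blast
    next
      case False
      define n where "n = nat (- c m)"
      have "\<phi> (B m) [^] c m \<otimes> \<phi> (B m) [^] n = \<phi> (B m) [^] (c m + int n)"
        using car by (simp add: int_pow_mult int_pow_int)
      also have "c m + int n = 0" using False by (simp add: n_def)
      finally have one: "\<phi> (B m) [^] c m \<otimes> \<phi> (B m) [^] n = \<one>" by simp
      have "prd (Suc m) \<otimes> \<phi> (B m ^ n * M) = (\<phi> (B m) [^] c m \<otimes> \<phi> (B m) [^] n) \<otimes> (prd m \<otimes> \<phi> M)"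
        unfolding prd_Suc \<phi>_pow[OF PM(2)] using car by (simp add: m_ac)
      also have "\<dots> = \<phi> P" unfolding one eq using car by simp
      finally have *: "prd (Suc m) \<otimes> \<phi> (B m ^ n * M) = \<phi> P" .
      have "B m ^ n * M \<in> D (Suc m)" "P \<in> D (Suc m)" using PM pow_D D by blast+
      with * show ?thesis by blast
    qed
  qed
  obtain P M where PM: "P \<in> D k" "M \<in> D k" and eq: "prd k \<otimes> \<phi> M = \<phi> P" using frac by blast
  note car = \<phi>B[of k] prd_closed[of k] \<phi>(1)[OF PM(1)] \<phi>(1)[OF PM(2)]
  have one: "\<phi> (B k) [^] c k \<otimes> prd k = \<one>" using rel prd_Suc[of k] by (simp only: prd_def)
  consider "c k = 0" | "c k > 0" | "c k < 0" by linarith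
  then show ?thesis
  proof cases
    case 2
    have "\<phi> (B k) [^] c k = \<phi> (B k) [^] nat (c k)"
      using int_pow_int[of G "\<phi> (B k)" "nat (c k)"] 2 by simp
    then have "\<phi> (B k ^ nat (c k) * P) = (\<phi> (B k) [^] c k \<otimes> prd k) \<otimes> \<phi> M"
      unfolding \<phi>_pow[OF PM(1)] eq[symmetric] using car by (simp add: m_assoc)
    then have "\<phi> (B k ^ nat (c k) * P) = \<phi> M" unfolding one using car by simp
    then show ?thesis using neq[OF PM] 2 by simp
  next
    \<comment> \<open>For a negative exponent \<open>P\<close> and \<open>M\<close> exchange roles:
      the power of \<open>B k\<close> now stands beside \<open>M\<close>.\<close>
    case 3
    define n where "n = nat (- c k)"
    have "\<phi> (B k) [^] n \<otimes> \<phi> (B k) [^] c k = \<phi> (B k) [^] (int n + c k)"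
      using car by (simp add: int_pow_mult int_pow_int)
    also have "int n + c k = 0" using 3 by (simp add: n_def)
    finally have *: "\<phi> (B k) [^] n \<otimes> \<phi> (B k) [^] c k = \<one>" by simp
    have "\<phi> (B k) [^] n = \<phi> (B k) [^] n \<otimes> (\<phi> (B k) [^] c k \<otimes> prd k)"
      unfolding one using car by simp
    also have "\<dots> = prd k" using car * by (simp add: m_assoc[symmetric])
    finally have "\<phi> (B k ^ n * M) = \<phi> P" unfolding \<phi>_pow[OF PM(2)] eq[symmetric] by simp
    then show ?thesis using neq[OF PM(2,1)] 3 by (simp add: n_def)
  qed
qed

section \<open>Quadratic extensions\<close>

text \<open>Normalising the trace to 1 makes the conjugate of \<open>t\<close> the integer
  polynomial 1 - \<open>t\<close>, so Z[t] is stable under conjugation. The last assumption says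
  that the class of \<open>t\<close> modulo the units of \<open>K\<close> has infinite
  order.\<close>

locale quadratic_generator = field L + K: subfield K L
  for L :: "('a, 'b) ring_scheme" (structure) and K +
  fixes t d :: 'a
  assumes t: "t \<in> carrier L" and d: "d \<in> K" and t_sq: "t \<otimes> t = t \<oplus> d"
    and pow_notin: "\<And>n::nat. n > 0 \<Longrightarrow> t [^] n \<notin> K"
begin

section \<open>Evaluation of integer polynomials at \<open>t\<close> and conjugation\<close>

lemma K_carrier [simp]: "x \<in> K \<Longrightarrow> x \<in> carrier L"
  using K.subset by blast

lemmas K_closed [simp] = subringE(2,3,5-7)[OF subfieldE(1)[OF K.subfield_axioms]]

lemma t_notin: "t \<notin> K"
  using pow_notin[of 1] t by simp

text \<open>Horner's scheme for the ring homomorphism from Z[X] to \<open>L\<close> that sends X to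
  \<open>t\<close>; \<open>add_pow L a \<one>\<close> is the image of the integer \<open>a\<close>.
  It links polynomials over a type class to a ring given as a record.\<close>

definition ev :: "int poly \<Rightarrow> 'a" where
  "ev P = fold_coeffs (\<lambda>a y. add_pow L a \<one> \<oplus> t \<otimes> y) P \<zero>"

lemma ev_0 [simp]: "ev 0 = \<zero>"
  by (simp add: ev_def)

lemma int_closed [simp]: "add_pow L (a::int) \<one> \<in> K"
proof -
  have nat: "add_pow L (n::nat) \<one> \<in> K" for n
    by (induction n) (simp_all add: add.nat_pow_Suc)
  show ?thesis
    by (cases "a \<ge> 0") (simp_all add: nat add_pow_int_ge add_pow_int_lt)
qed

lemma int_0 [simp]: "add_pow L (0::int) \<one> = \<zero>"
  by (simp add: add_pow_int_ge)

lemma int_add: "add_pow L (a + b :: int) \<one> = add_pow L a \<one> \<oplus> add_pow L b \<one>"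
  by (simp add: add.int_pow_mult)

lemma ev_pCons [simp]: "ev (pCons a P) = add_pow L a \<one> \<oplus> t \<otimes> ev P"
  by (cases "a = 0 \<and> P = 0") (auto simp: ev_def t)

lemma ev_closed [simp]: "ev P \<in> carrier L"
  by (induction P) (simp_all add: t)

lemma ev_add: "ev (P + Q) = ev P \<oplus> ev Q"
proof (induction P Q rule: poly_induct2)
  case (pCons a p b q)
  then show ?case
    by (simp add: t r_distr int_add add.m_ac)
qed simp

lemma ev_smult: "ev (smult a P) = add_pow L a \<one> \<otimes> ev P"
proof (induction P)
  case (pCons b P)
  have "add_pow L (a * b) \<one> = add_pow L a \<one> \<otimes> add_pow L b \<one>"
    by (simp add: add_pow_ldistr_int add.int_pow_pow mult.commute)
  with pCons show ?case by (simp add: t r_distr m_ac)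
qed simp

lemma ev_mult: "ev (P * Q) = ev P \<otimes> ev Q"
  by (induction P) (simp_all add: ev_add ev_smult t l_distr r_distr m_ac)

lemma ev_1 [simp]: "ev 1 = \<one>"
  by (simp add: one_pCons t add.int_pow_1)

lemma ev_uminus: "ev (- P) = \<ominus> ev P"
  using ev_add[of "- P" P] by (simp add: minus_equality)

lemma ev_diff: "ev (P - Q) = ev P \<ominus> ev Q"
  using ev_add[of P "- Q"] by (simp add: ev_uminus minus_eq)

lemma ev_power: "ev (P ^ n) = ev P [^] n"
  by (induction n) (simp_all add: ev_mult m_comm)

lemma ev_X [simp]: "ev [:0, 1:] = t"
  by (simp add: t add.int_pow_1)

text \<open>If the coefficients of \<open>t\<close> differed, dividing by their difference would put
  \<open>t\<close> into \<open>K\<close>.\<close>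

lemma coordinates_unique:
  assumes "p\<^sub>0 \<in> K" "p\<^sub>1 \<in> K" "q\<^sub>0 \<in> K" "q\<^sub>1 \<in> K" and eq: "p\<^sub>0 \<oplus> p\<^sub>1 \<otimes> t = q\<^sub>0 \<oplus> q\<^sub>1 \<otimes> t"
  shows "p\<^sub>0 = q\<^sub>0" "p\<^sub>1 = q\<^sub>1"
proof -
  note c = assms(1-4)[THEN K_carrier]
  have "(p\<^sub>1 \<ominus> q\<^sub>1) \<otimes> t = (p\<^sub>0 \<oplus> p\<^sub>1 \<otimes> t) \<ominus> (p\<^sub>0 \<oplus> q\<^sub>1 \<otimes> t)"
    using c t by algebra
  also have "\<dots> = q\<^sub>0 \<ominus> p\<^sub>0" unfolding eq using c t by algebra
  finally have *: "(p\<^sub>1 \<ominus> q\<^sub>1) \<otimes> t = q\<^sub>0 \<ominus> p\<^sub>0" .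
  show 1: "p\<^sub>1 = q\<^sub>1"
  proof (rule ccontr)
    assume "p\<^sub>1 \<noteq> q\<^sub>1"
    then have u: "p\<^sub>1 \<ominus> q\<^sub>1 \<in> K - {\<zero>}" using assms(1-4) c r_right_minus_eq
      by (simp add: minus_eq)
    have "inv (p\<^sub>1 \<ominus> q\<^sub>1) \<in> K" using subfield_m_inv(1)[OF K.subfield_axioms u] by simp
    moreover have "t = inv (p\<^sub>1 \<ominus> q\<^sub>1) \<otimes> ((p\<^sub>1 \<ominus> q\<^sub>1) \<otimes> t)"
      using subfield_m_inv[OF K.subfield_axioms u] t c by (simp add: m_assoc[symmetric])
    moreover have "q\<^sub>0 \<ominus> p\<^sub>0 \<in> K" using assms(1-4) by (simp add: minus_eq K_closed)
    ultimately have "t \<in> K" unfolding * using K_closed(4) by simp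
    then show False using t_notin by blast
  qed
  show "p\<^sub>0 = q\<^sub>0" using eq c t unfolding 1 by simp
qed

text \<open>The conjugate of \<open>t\<close> over \<open>K\<close> is \<open>1 - t\<close>, so \<open>ev (refl_poly P)\<close> is the conjugate of \<open>ev P\<close>.\<close>

lemma ev_coordinates:
  obtains p\<^sub>0 p\<^sub>1 where "p\<^sub>0 \<in> K" "p\<^sub>1 \<in> K" "ev P = p\<^sub>0 \<oplus> p\<^sub>1 \<otimes> t"
    "ev (refl_poly P) = p\<^sub>0 \<oplus> p\<^sub>1 \<otimes> (\<one> \<ominus> t)"
proof -
  have "\<exists>p\<^sub>0\<in>K. \<exists>p\<^sub>1\<in>K. ev P = p\<^sub>0 \<oplus> p\<^sub>1 \<otimes> t \<and> ev (refl_poly P) = p\<^sub>0 \<oplus> p\<^sub>1 \<otimes> (\<one> \<ominus> t)"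
  proof (induction P)
    case 0
    then show ?case using t by (intro bexI[of _ \<zero>]) (auto simp: K_closed)
  next
    case (pCons a P)
    then obtain p\<^sub>0 p\<^sub>1 where p: "p\<^sub>0 \<in> K" "p\<^sub>1 \<in> K" and P: "ev P = p\<^sub>0 \<oplus> p\<^sub>1 \<otimes> t"
      "ev (refl_poly P) = p\<^sub>0 \<oplus> p\<^sub>1 \<otimes> (\<one> \<ominus> t)" by blast
    define a' where "a' = add_pow L a \<one>"
    have a': "a' \<in> K" by (simp add: a'_def)
    have c: "p\<^sub>0 \<in> carrier L" "p\<^sub>1 \<in> carrier L" "a' \<in> carrier L" "d \<in> carrier L" using p a' d by auto
    have "ev (pCons a P) = a' \<oplus> p\<^sub>0 \<otimes> t \<oplus> p\<^sub>1 \<otimes> (t \<otimes> t)"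
      unfolding ev_pCons P a'_def[symmetric] using c t by algebra
    also have "\<dots> = (a' \<oplus> p\<^sub>1 \<otimes> d) \<oplus> (p\<^sub>0 \<oplus> p\<^sub>1) \<otimes> t"
      unfolding t_sq using c t by algebra
    finally have 1: "ev (pCons a P) = (a' \<oplus> p\<^sub>1 \<otimes> d) \<oplus> (p\<^sub>0 \<oplus> p\<^sub>1) \<otimes> t" .
    have "ev (refl_poly (pCons a P)) = a' \<oplus> (\<one> \<ominus> t) \<otimes> ev (refl_poly P)"
    proof -
      have "ev [:1, -1:] = \<one> \<ominus> t"
        using t by (simp add: add.int_pow_1 minus_eq add.int_pow_neg r_minus)
      moreover have "ev [:a:] = a'" using t by (simp add: a'_def)
      ultimately show ?thesis unfolding pcompose_pCons ev_add ev_mult by simp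
    qed
    also have "\<dots> = a' \<oplus> p\<^sub>0 \<otimes> (\<one> \<ominus> t) \<oplus> p\<^sub>1 \<otimes> (\<one> \<ominus> t \<ominus> t \<oplus> t \<otimes> t)"
      unfolding P using c t by algebra
    also have "\<dots> = (a' \<oplus> p\<^sub>1 \<otimes> d) \<oplus> (p\<^sub>0 \<oplus> p\<^sub>1) \<otimes> (\<one> \<ominus> t)"
      unfolding t_sq using c t by algebra
    finally have 2: "ev (refl_poly (pCons a P)) = (a' \<oplus> p\<^sub>1 \<otimes> d) \<oplus> (p\<^sub>0 \<oplus> p\<^sub>1) \<otimes> (\<one> \<ominus> t)" .
    show ?case using 1 2 p a' d by (blast intro: K_closed)
  qed
  then show thesis using that by blast
qed

text \<open>Conjugation fixes \<open>k\<close>, so comparing coordinates with respect to 1 and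
  \<open>t\<close> carries the equation over to the conjugates. With \<open>M = 0\<close> it shows
  that the kernel of \<open>ev\<close> is stable under reflection.\<close>

lemma ev_refl_poly:
  assumes k: "k \<in> K" and eq: "ev P = k \<otimes> ev M"
  shows "ev (refl_poly P) = k \<otimes> ev (refl_poly M)"
proof -
  obtain p\<^sub>0 p\<^sub>1 where p: "p\<^sub>0 \<in> K" "p\<^sub>1 \<in> K" "ev P = p\<^sub>0 \<oplus> p\<^sub>1 \<otimes> t"
    "ev (refl_poly P) = p\<^sub>0 \<oplus> p\<^sub>1 \<otimes> (\<one> \<ominus> t)" by (rule ev_coordinates)
  obtain m\<^sub>0 m\<^sub>1 where m: "m\<^sub>0 \<in> K" "m\<^sub>1 \<in> K" "ev M = m\<^sub>0 \<oplus> m\<^sub>1 \<otimes> t"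
    "ev (refl_poly M) = m\<^sub>0 \<oplus> m\<^sub>1 \<otimes> (\<one> \<ominus> t)" by (rule ev_coordinates)
  have c: "m\<^sub>0 \<in> carrier L" "m\<^sub>1 \<in> carrier L" "k \<in> carrier L" using m k by auto
  have "p\<^sub>0 \<oplus> p\<^sub>1 \<otimes> t = k \<otimes> m\<^sub>0 \<oplus> (k \<otimes> m\<^sub>1) \<otimes> t"
    unfolding p(3)[symmetric] eq m(3) using c t by algebra
  from coordinates_unique[OF _ _ _ _ this] have "p\<^sub>0 = k \<otimes> m\<^sub>0" "p\<^sub>1 = k \<otimes> m\<^sub>1"
    using p m k by simp_all
  then show ?thesis unfolding p(4) m(4) using c t by algebra
qed

text \<open>The kernel of \<open>ev\<close> is prime because \<open>L\<close> has no zero divisors;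
  computing modulo it is computing in Z[t].\<close>

sublocale poly_prime_ideal "{P. ev P = \<zero>}"
  by unfold_locales (auto simp: ev_add ev_mult integral_iff)

lemma exists_independent_values:
  obtains B D where "\<And>k. ev (B k) \<noteq> \<zero>" "\<And>k. B k \<in> D (Suc k)" "\<And>k. 1 \<in> D k" "\<And>k. D k \<subseteq> D (Suc k)"
    "\<And>k P Q. P \<in> D k \<Longrightarrow> Q \<in> D k \<Longrightarrow> P * Q \<in> D k" "\<And>k P. P \<in> D k \<Longrightarrow> ev P \<noteq> \<zero>"
    "\<And>k (n::nat) P M x. P \<in> D k \<Longrightarrow> M \<in> D k \<Longrightarrow> x \<in> K \<Longrightarrow> n > 0 \<Longrightarrow>
       ev (B k ^ n * P) \<noteq> x \<otimes> ev M"
proof -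
  have "t \<noteq> \<zero>" using t_notin K_closed by metis
  then have X: "[:0, 1:] \<notin> {P. ev P = \<zero>}" by (simp add: t)
  have pow: "[:0, 1:] ^ n - 1 \<notin> {P. ev P = \<zero>}" if "n > 0" for n
    using pow_notin[OF that] K_closed t by (auto simp: ev_diff ev_power)
  have refl: "refl_poly P \<in> {P. ev P = \<zero>}" if "P \<in> {P. ev P = \<zero>}" for P
    using that ev_refl_poly[of \<one> P 0] by (simp add: K_closed)
  \<comment> \<open>The coordinate of 1 in 1 - 2\<open>t\<close> is 1, so the value is nonzero in
    characteristic 2 as well.\<close>
  have d: "[:1, -2:] \<notin> {P. ev P = \<zero>}"
  proof
    assume "[:1, -2:] \<in> {P. ev P = \<zero>}"
    then have "\<one> \<oplus> add_pow L (-2::int) \<one> \<otimes> t = \<zero> \<oplus> \<zero> \<otimes> t"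
      using t by (simp add: add.int_pow_1 m_comm)
    from coordinates_unique(1)[OF _ _ _ _ this] show False by (simp add: K_closed)
  qed
  obtain B D where BD: "\<And>k. B k \<notin> {P. ev P = \<zero>}" "\<And>k. B k \<in> D (Suc k)" "\<And>k. 1 \<in> D k"
    "\<And>k. D k \<subseteq> D (Suc k)" "\<And>k P Q. P \<in> D k \<Longrightarrow> Q \<in> D k \<Longrightarrow> P * Q \<in> D k"
    "\<And>k P. P \<in> D k \<Longrightarrow> P \<notin> {P. ev P = \<zero>}"
    "\<And>k n P M. P \<in> D k \<Longrightarrow> M \<in> D k \<Longrightarrow>
       B k ^ Suc n * P * refl_poly M - refl_poly (B k ^ Suc n * P) * M \<notin> {P. ev P = \<zero>}"
    using exists_independent_polys[OF X pow refl d] by blast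
  show thesis
  proof (rule that[of B D])
    fix k n :: nat and P M x assume PM: "P \<in> D k" "M \<in> D k" and x: "x \<in> K" and n: "n > 0"
    show "ev (B k ^ n * P) \<noteq> x \<otimes> ev M"
    proof
      assume eq: "ev (B k ^ n * P) = x \<otimes> ev M"
      \<comment> \<open>Multiplying the equation and its conjugate crosswise eliminates
        \<open>x\<close>.\<close>
      have "ev (B k ^ n * P * refl_poly M - refl_poly (B k ^ n * P) * M) = \<zero>"
        unfolding ev_diff ev_mult[of _ M] ev_mult[of _ "refl_poly M"] eq ev_refl_poly[OF x eq]
        using x by (simp add: m_ac minus_eq r_neg)
      then show False using BD(7)[OF PM, of "n - 1"] n by simp
    qed
  qed (use BD in auto)
qed

end

section \<open>Passage to the quotient of the unit groups\<close>

lemma (in field) subgroup_units_of_subfield: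
  assumes "subfield K R"
  shows "subgroup (K - {\<zero>}) (units_of R)"
proof -
  interpret U: group "units_of R" by (rule units_group)
  note K = subringE[OF subfieldE(1)[OF assms]]
  have carrier: "K - {\<zero>} \<subseteq> Units R" using K(1) field_Units by auto
  show ?thesis
  proof (rule U.subgroupI)
    fix a assume a: "a \<in> K - {\<zero>}"
    then have "inv\<^bsub>units_of R\<^esub> a = inv a" using carrier units_of_inv by blast
    then show "inv\<^bsub>units_of R\<^esub> a \<in> K - {\<zero>}" using subfield_m_inv(1)[OF assms a] by simp
  next
    fix a b assume "a \<in> K - {\<zero>}" "b \<in> K - {\<zero>}"
    then show "a \<otimes>\<^bsub>units_of R\<^esub> b \<in> K - {\<zero>}"
      using K(1,6) integral[of a b] by (auto simp: units_of_mult)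
  qed (use carrier K(3) in \<open>auto simp: units_of_carrier\<close>)
qed

context quadratic_generator
begin

lemma infinite_maximal_Z_independent:
  assumes "maximal_Z_independent (units_of L Mod (K - {\<zero>})) S"
  shows "infinite S"
proof -
  let ?U = "units_of L" and ?H = "K - {\<zero>}"
  let ?A = "?U Mod ?H"
  interpret U: comm_group ?U by (rule units_comm_group)
  have sub: "subgroup ?H ?U" by (rule subgroup_units_of_subfield) (rule K.subfield_axioms)
  interpret A: comm_group ?A using U.abelian_FactGroup sub by blast
  interpret N: normal ?H ?U using U.subgroup_imp_normal sub by blast
  obtain B D where BD: "\<And>k. ev (B k) \<noteq> \<zero>" "\<And>k. B k \<in> D (Suc k)" "\<And>k. 1 \<in> D k" "\<And>k. D k \<subseteq> D (Suc k)"
    "\<And>k P Q. P \<in> D k \<Longrightarrow> Q \<in> D k \<Longrightarrow> P * Q \<in> D k" "\<And>k P. P \<in> D k \<Longrightarrow> ev P \<noteq> \<zero>"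
    "\<And>k (n::nat) P M x. P \<in> D k \<Longrightarrow> M \<in> D k \<Longrightarrow> x \<in> K \<Longrightarrow> n > 0 \<Longrightarrow>
       ev (B k ^ n * P) \<noteq> x \<otimes> ev M"
    using exists_independent_values by blast
  define \<phi> where "\<phi> P = ?H #>\<^bsub>?U\<^esub> ev P" for P
  have unit: "ev P \<in> carrier ?U" if "ev P \<noteq> \<zero>" for P
    using that by (simp add: units_of_carrier field_Units)
  have closed: "\<phi> P \<in> carrier ?A" if "ev P \<noteq> \<zero>" for P
    using unit[OF that] by (simp add: carrier_FactGroup \<phi>_def)
  have mult: "\<phi> (P * Q) = \<phi> P \<otimes>\<^bsub>?A\<^esub> \<phi> Q" if "ev P \<noteq> \<zero>" "ev Q \<noteq> \<zero>" for P Q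
    using N.rcos_sum[OF unit unit] that by (simp add: \<phi>_def ev_mult units_of_mult)
  have neq: "\<phi> (B k ^ n * P) \<noteq> \<phi> M" if PM: "P \<in> D k" "M \<in> D k" "n > 0" for k n P M
  proof
    assume eq: "\<phi> (B k ^ n * P) = \<phi> M"
    have "ev (B k ^ n * P) \<noteq> \<zero>"
    proof -
      have "B k ^ n \<in> D (Suc k)" by (induction n) (simp_all add: BD)
      then have "B k ^ n * P \<in> D (Suc k)" using PM(1) BD(4,5) by blast
      then show ?thesis by (rule BD(6))
    qed
    \<comment> \<open>Equal cosets mean that the two values differ by a factor from
      \<open>K\<close>, which is the excluded equation.\<close>
    from unit[OF this] have "ev (B k ^ n * P) \<in> \<phi> (B k ^ n * P)"
      unfolding \<phi>_def by (rule U.rcos_self) (rule sub)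
    then obtain h where "h \<in> ?H" "ev (B k ^ n * P) = h \<otimes> ev M"
      unfolding eq unfolding \<phi>_def r_coset_def units_of_mult by blast
    then show False using BD(7)[OF PM(1,2) _ PM(3)] by blast
  qed
  have one: "\<phi> 1 = \<one>\<^bsub>?A\<^esub>"
    using N.rcos_const[OF U.is_group, of \<one>] by (simp add: \<phi>_def K_closed)
  show ?thesis
  proof (rule A.infinite_maximal_Z_independent[OF assms, of "\<lambda>i. \<phi> (B i)"])
    show "\<phi> (B i) \<in> carrier ?A" for i using closed BD(1) by blast
    show "c k = 0" if "finprod ?A (\<lambda>i. \<phi> (B i) [^]\<^bsub>?A\<^esub> c i) {..<Suc k} = \<one>\<^bsub>?A\<^esub>"
      for c :: "nat \<Rightarrow> int" and k
    proof (rule A.last_exponent_zero[where \<phi> = \<phi> and B = B and D = D, OF BD(2-5) _ one _ neq that])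
      show "\<phi> P \<in> carrier ?A" if "P \<in> D k" for k P
        using closed BD(6)[OF that] by blast
      show "\<phi> (P * Q) = \<phi> P \<otimes>\<^bsub>?A\<^esub> \<phi> Q" if "P \<in> D k" "Q \<in> D k" for k P Q
        using that by (intro mult BD(6))
    qed
  qed
qed

end

text \<open>In degree 2 the elements \<open>x\<close> and 1 form a basis, whence \<open>x\<close> is
  a root of a quadratic with trace \<open>s\<close>. If \<open>s\<close> were zero, the square of
  \<open>x\<close> would lie in \<open>K\<close>. Dividing \<open>x\<close> by \<open>s\<close>
  normalises the trace to 1 and keeps the class modulo the units of \<open>K\<close>, so still no
  positive power lies in \<open>K\<close>.\<close>

lemma (in field) exists_quadratic_generator:
  assumes K: "subfield K R" and dim: "dimension 2 K (carrier R)"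
    and x: "x \<in> carrier R" and pow: "\<And>n::nat. n > 0 \<Longrightarrow> x [^] n \<notin> K"
  obtains t d where "quadratic_generator R K t d"
proof -
  note K_closed = subringE[OF subfieldE(1)[OF K]]
  have K_carrier: "k \<in> carrier R" if "k \<in> K" for k using that K_closed(1) by blast
  have Span_one: "Span K [\<one>] = K"
    using K_carrier K_closed by (auto simp: line_extension_mem_iff)
  have x_notin: "x \<notin> K" using pow[of 1] x by simp
  have "independent K [x, \<one>]"
    using x x_notin Span_one one_not_zero by (intro li_Cons) auto
  then have span: "Span K [x, \<one>] = carrier R"
    using independent_length_eq_dimension[OF K dim, of "[x, \<one>]"] x by simp
  have "x \<otimes> x \<in> line_extension K x (Span K [\<one>])" using span x by simp
  then obtain s c where s: "s \<in> K" and c: "c \<in> K" and x_sq: "x \<otimes> x = s \<otimes> x \<oplus> c"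
    unfolding Span_one line_extension_mem_iff by blast
  have s0: "s \<noteq> \<zero>"
  proof
    assume "s = \<zero>"
    then have "x [^] (2::nat) \<in> K" using x_sq x c K_carrier by (simp add: numeral_2_eq_2)
    then show False using pow[of 2] by simp
  qed
  define i where "i = inv s"
  have i: "i \<in> K" "s \<otimes> i = \<one>"
    using subfield_m_inv[OF K, of s] s s0 by (auto simp: i_def)
  note car = x s[THEN K_carrier] c[THEN K_carrier] i(1)[THEN K_carrier]
  have "quadratic_generator R K (i \<otimes> x) (i \<otimes> i \<otimes> c)"
  proof (intro quadratic_generator.intro quadratic_generator_axioms.intro)
    show "field R" by (rule field_axioms)
    show "subfield K R" by (rule K)
    show "i \<otimes> x \<in> carrier R" "i \<otimes> i \<otimes> c \<in> K" using car K_closed i c by auto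
    have "i \<otimes> x \<otimes> (i \<otimes> x) = i \<otimes> i \<otimes> (x \<otimes> x)" using car by algebra
    also have "\<dots> = (s \<otimes> i) \<otimes> i \<otimes> x \<oplus> i \<otimes> i \<otimes> c" unfolding x_sq using car by algebra
    finally show "i \<otimes> x \<otimes> (i \<otimes> x) = i \<otimes> x \<oplus> i \<otimes> i \<otimes> c" unfolding i(2) using car by simp
    fix n :: nat assume n: "n > 0"
    have pow_K: "s [^] n \<in> K" by (induction n) (simp_all add: K_closed s)
    show "(i \<otimes> x) [^] n \<notin> K"
    proof
      assume "(i \<otimes> x) [^] n \<in> K"
      then have "s [^] n \<otimes> (i \<otimes> x) [^] n \<in> K" using pow_K K_closed by blast
      also have "s [^] n \<otimes> (i \<otimes> x) [^] n = (s \<otimes> (i \<otimes> x)) [^] n"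
        using car by (simp add: nat_pow_distrib)
      also have "s \<otimes> (i \<otimes> x) = x" using car i(2) by (simp add: m_assoc[symmetric])
      finally show False using pow[OF n] by blast
    qed
  qed
  then show thesis by (rule that)
qed

theorem theorem3p3:
  fixes L :: "('a, 'b) ring_scheme" and K :: "'a set" and A :: "'a set monoid"
  assumes "field L"
    and "subfield K L"
    and "ring.dimension L 2 K (carrier L)"
    and "A = units_of L Mod (K - {\<zero>\<^bsub>L\<^esub>})"
  shows "rational_rank A =o (czero :: 'a set rel) \<or> cinfinite (rational_rank A)"
proof -
  interpret field L by fact
  let ?U = "units_of L" and ?H = "K - {\<zero>\<^bsub>L\<^esub>}"
  interpret U: comm_group ?U by (rule units_comm_group)
  have sub: "subgroup ?H ?U" using subgroup_units_of_subfield assms(2) by blast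
  interpret A: comm_group A unfolding assms(4) using U.abelian_FactGroup sub by blast
  interpret N: normal ?H ?U using U.subgroup_imp_normal sub by blast
  define S where "S = (SOME S. maximal_Z_independent A S)"
  have S: "maximal_Z_independent A S"
    unfolding S_def using maximal_Z_independent_exists by (rule someI_ex)
  show ?thesis
  proof (cases "S = {}")
    case True
    then show ?thesis
      by (simp add: rational_rank_def S_def[symmetric] czero_def card_of_empty_ordIso)
  next
    case False
    then obtain y where y: "y \<in> S" by blast
    have ind: "Z_independent A S" using S by (simp add: maximal_Z_independent_def)
    have y_carrier: "y \<in> carrier A" using ind y by (auto simp: Z_independent_def)
    then obtain x where x: "x \<in> carrier ?U" and y_eq: "y = ?H #>\<^bsub>?U\<^esub> x"
      unfolding assms(4) carrier_FactGroup by blast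
    have xL: "x \<in> carrier L" "x \<noteq> \<zero>\<^bsub>L\<^esub>" using x by (auto simp: units_of_carrier field_Units)
    \<comment> \<open>A positive power of \<open>x\<close> in \<open>K\<close> would be a nontrivial
      relation on \<open>{y}\<close>, against the independence of \<open>S\<close>.\<close>
    have "x [^]\<^bsub>L\<^esub> n \<notin> K" if n: "n > 0" for n :: nat
    proof
      assume "x [^]\<^bsub>L\<^esub> n \<in> K"
      then have "x [^]\<^bsub>?U\<^esub> n \<in> ?H"
        using x U.nat_pow_closed[OF x, of n] field_Units units_of_pow[of x n] by (simp add: units_of_carrier)
      then have "y [^]\<^bsub>A\<^esub> n = \<one>\<^bsub>A\<^esub>"
        unfolding assms(4) y_eq N.FactGroup_pow[OF x] using N.rcos_const[OF U.is_group] by simp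
      then have "finprod A (\<lambda>z. z [^]\<^bsub>A\<^esub> (int n)) {y} = \<one>\<^bsub>A\<^esub>"
        using y_carrier by (simp add: int_pow_int)
      then have "int n = 0"
        using ind[unfolded Z_independent_def, THEN conjunct2, rule_format, of "{y}" "\<lambda>_. int n" y] y
        by simp
      then show False using n by simp
    qed
    then obtain t d where "quadratic_generator L K t d"
      using exists_quadratic_generator[OF assms(2,3) xL(1)] by blast
    from quadratic_generator.infinite_maximal_Z_independent[OF this S[unfolded assms(4)]]
    have "infinite S" .
    then show ?thesis by (simp add: rational_rank_def S_def[symmetric] cinfinite_def)
  qed
qed

end
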